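(* Let $\mathcal Z\subseteq\mathbb R^d$ be a compact convex set with $\operatorname{int}\mathcal Z\neq\emptyset$, let $\gamma>0$, and set $a=1$. Suppose that for $\mathbb P_{\bm x}$-almost every $\bm x$: (1) $\mathbb E_{\bm y\sim\mathbb P_{\bm y|\bm x}}[\|\bm y\|_2]<\infty$; (2) with $\bar{\bm y}=\bar{\bm y}(\bm x)=\mathbb E_{\bm y\sim\mathbb P_{\bm y|\bm x}}[\bm y]$, the nominal problem $\min_{\bm z\in\mathcal Z}\bar{\bm y}^\top\bm z$ has a unique optimal solution $\bm z^\star(\bar{\bm y})$; (3) $\mathbb P_{\bm y|\bm x}$ admits a density that is positive on an open set containing $2\bar{\bm y}+\gamma\mathcal Z$ and is centrally symmetric about $\bar{\bm y}$. Define $$\bar\gamma(\bm x):=\sup\Big\{\gamma'\ge 0:\ 2\bar{\bm y}+\gamma'\bm z^\star(\bar{\bm y})\in-\mathcal N_{\mathcal Z}\big(\bm z^\star(\bar{\bm y})\big)\Big\}\in[0,+\infty].\qquad( * )$$ Then: (i) The set in $( * )$ is a closed interval containing $0$, so $\bar\gamma(\bm x)$ is well-defined and is attained whenever it is finite. If $0<\gamma\le\bar\gamma(\bm x)$ for $\mathbb P_{\bm x}$-almost every $\bm x$, then for $\mathbb P_{\bm x}$-almost every $\bm x$ the unique minimizer $2\bar{\bm y}(\bm x)$ of the pointwise $\mathcal{RSPO}_+$ risk $\hat{\bm y}\mapsto\mathbb E_{\bm y\sim\mathbb P_{\bm y|\bm x}}[\ell_{\mathcal{RSPO}_+}(\hat{\bm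 y},\bm y)]$ over $\mathbb R^d$ is also a minimizer of the pointwise $\mathcal{RSPO}$ risk $\hat{\bm y}\mapsto\mathbb E_{\bm y\sim\mathbb P_{\bm y|\bm x}}[\ell_{\mathcal{RSPO}}(\hat{\bm y},\bm y)]$ over $\mathbb R^d$. That is, the $\mathcal{RSPO}_+$ loss is Fisher consistent with the $\mathcal{RSPO}$ loss. (ii) Suppose in addition that $\mathcal Z=\{\bm z\in\mathbb R^d:\bm A\bm z\ge\bm b\}$ is a nonempty bounded polyhedron. Then, for $\mathbb P_{\bm x}$-almost every $\bm x$, the threshold is strictly positive: $$\bar\gamma(\bm x)\ \ge\ \frac{2\,\operatorname{dist}\big(\bar{\bm y}(\bm x),\partial\mathcal C(\bm x)\big)}{\|\bm z^\star(\bar{\bm y}(\bm x))\|_2}\ >\ 0,\qquad \mathcal C(\bm x):=-\mathcal N_{\mathcal Z}\big(\bm z^\star(\bar{\bm y}(\bm x))\big),$$ where $\partial\mathcal C(\bm x)$ is the boundary of $\mathcal C(\bm x)$, and when $\bm z^\star(\bar{\bm y}(\bm x))=\bm 0$ one has $\bar\gamma(\bm x)=+\infty$ (and the bound is regarded as holding trivially). In particular, the set of $\gamma>0$ with $\gamma\le\bar\gamma(\bm x)$ is nonempty for $\mathbb P_{\bm x}$-almost every $\bm x$.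
   Context: $(\bm x,\bm y)\sim\mathbb P$ with values in $\mathcal X\times\mathcal Y$, $\mathcal X\subseteq\mathbb R^p$, $\mathcal Y\subseteq\mathbb R^d$; $\mathbb P_{\bm x}$ and $\mathbb P_{\bm y|\bm x}$ are the marginal and conditional distributions. $\mathcal N_{\mathcal Z}(\bm z)=\{\bm n:\bm n^\top(\bm w-\bm z)\le 0\ \forall\bm w\in\mathcal Z\}$ is the normal cone; $\operatorname{dist}$ is Euclidean distance. $v^\star(\bm y)=\min_{\bm z\in\mathcal Z}\bm y^\top\bm z$; $\bm z^\star_\gamma(\bm y)$ is the unique minimizer of $\bm y^\top\bm z+\frac{\gamma}{2}\|\bm z\|_2^2$ over $\bm z\in\mathcal Z$. $\mathcal{RSPO}$ loss: $\ell_{\mathcal{RSPO}}(\hat{\bm y},\bm y)=\bm y^\top\bm z^\star_\gamma(\hat{\bm y})-v^\star(\bm y)$. $\mathcal{RSPO}_+$ loss with parameter $a>0$: $\ell_{\mathcal{RSPO}_+}(\hat{\bm y},\bm y)=\max_{\bm z\in\mathcal Z}\{\bm y^\top\bm z-a\hat{\bm y}^\top\bm z-\frac{a\gamma}{2}\|\bm z\|_2^2\}+a\{\bm z^\star_\gamma(\bm y)^\top\hat{\bm y}+\frac{\gamma}{2}\|\bm z^\star_\gamma(\bm y)\|_2^2\}-v^\star(\bm y)$. Fisher consistency of a loss $\ell$ with respect to $\ell_{\mathcal{RSPO}}$ means that every minimizer of $\mathbb E_{\mathbb P}[\ell(\bm g(\bm x),\bm y)]$ over all measurable $\bm g:\mathcal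 X\to\mathbb R^d$ also minimizes $\mathbb E_{\mathbb P}[\ell_{\mathcal{RSPO}}(\bm g(\bm x),\bm y)]$ over all measurable $\bm g$. It is understood pointwise: it amounts to the inclusion $\operatorname{argmin}_{\hat{\bm y}\in\mathbb R^d}\mathbb E_{\bm y\sim\mathbb P_{\bm y|\bm x}}[\ell(\hat{\bm y},\bm y)]\subseteq\operatorname{argmin}_{\hat{\bm y}\in\mathbb R^d}\mathbb E_{\bm y\sim\mathbb P_{\bm y|\bm x}}[\ell_{\mathcal{RSPO}}(\hat{\bm y},\bm y)]$ for $\mathbb P_{\bm x}$-almost every $\bm x$. *)

theory Defs
  imports "HOL-Probability.Probability"
begin

definition argmin_set :: "('a \<Rightarrow> real) \<Rightarrow> 'a set \<Rightarrow> 'a set" where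
  "argmin_set f S = {x. is_arg_min f (\<lambda>z. z \<in> S) x}"

definition normal_cone :: "'a::euclidean_space set \<Rightarrow> 'a \<Rightarrow> 'a set" where
  "normal_cone Z z = {n. \<forall>w\<in>Z. n \<bullet> (w - z) \<le> 0}"

text \<open>
  All uses below are for a nonempty compact convex set \<open>Z\<close>, so the infimum (supremum) over \<open>Z\<close> of a
  continuous function is a minimum (maximum). The definite descriptions are meaningful for \<open>\<gamma> > 0\<close>
  (strict convexity) and, in the case of \<open>z_star\<close>, when the linear problem has exactly one solution.
\<close>

definition v_star :: "'a::euclidean_space set \<Rightarrow> 'a \<Rightarrow> real" where
  "v_star Z y = (INF z\<in>Z. y \<bullet> z)"

definition z_star :: "'a::euclidean_space set \<Rightarrow> 'a \<Rightarrow> 'a" where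
  "z_star Z y = (THE z. z \<in> argmin_set (\<lambda>z. y \<bullet> z) Z)"

definition z_star_reg :: "real \<Rightarrow> 'a::euclidean_space set \<Rightarrow> 'a \<Rightarrow> 'a" where
  "z_star_reg \<gamma> Z y = (THE z. z \<in> argmin_set (\<lambda>z. y \<bullet> z + \<gamma> / 2 * (norm z)\<^sup>2) Z)"

text \<open>Both losses take the prediction first and the realised cost vector second.\<close>

definition rspo_loss :: "real \<Rightarrow> 'a::euclidean_space set \<Rightarrow> 'a \<Rightarrow> 'a \<Rightarrow> real" where
  "rspo_loss \<gamma> Z yhat y = y \<bullet> z_star_reg \<gamma> Z yhat - v_star Z y"

definition rspo_plus_loss :: "real \<Rightarrow> real \<Rightarrow> 'a::euclidean_space set \<Rightarrow> 'a \<Rightarrow> 'a \<Rightarrow> real" where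
  "rspo_plus_loss a \<gamma> Z yhat y =
     (SUP z\<in>Z. y \<bullet> z - a * (yhat \<bullet> z) - a * \<gamma> / 2 * (norm z)\<^sup>2)
     + a * (z_star_reg \<gamma> Z y \<bullet> yhat + \<gamma> / 2 * (norm (z_star_reg \<gamma> Z y))\<^sup>2)
     - v_star Z y"

text \<open>
  \<open>K\<close> is a regular conditional distribution of the second component given the first: a Markov kernel
  which together with the first marginal determines \<open>P\<close>.
\<close>

definition is_cond_distribution ::
  "('a::euclidean_space \<times> 'b::euclidean_space) measure \<Rightarrow> ('a \<Rightarrow> 'b measure) \<Rightarrow> bool" where
  "is_cond_distribution P K \<longleftrightarrow>
     K \<in> borel \<rightarrow>\<^sub>M prob_algebra borel \<and>
     (\<forall>A\<in>sets borel. \<forall>B\<in>sets borel.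
        emeasure P (A \<times> B) = (\<integral>\<^sup>+x\<in>A. emeasure (K x) B \<partial>(distr P borel fst)))"

definition cond_mean :: "'a::euclidean_space measure \<Rightarrow> 'a" where
  "cond_mean Q = (\<integral>y. y \<partial>Q)"

text \<open>
  For compact \<open>Z\<close> and \<open>Q\<close> with finite first moment, both losses are \<open>Q\<close>-integrable in \<open>y\<close> for every
  prediction, so the Bochner integral is the genuine expectation. Fisher consistency is the pointwise
  notion (almost every covariate value); predictions range over the whole space.
\<close>

definition pointwise_risk ::
  "('a \<Rightarrow> 'a \<Rightarrow> real) \<Rightarrow> 'a::euclidean_space measure \<Rightarrow> 'a \<Rightarrow> real" where
  "pointwise_risk loss Q yhat = (\<integral>y. loss yhat y \<partial>Q)"

definition fisher_consistent ::
  "'x measure \<Rightarrow> ('x \<Rightarrow> 'a::euclidean_space measure) \<Rightarrow>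
     ('a \<Rightarrow> 'a \<Rightarrow> real) \<Rightarrow> ('a \<Rightarrow> 'a \<Rightarrow> real) \<Rightarrow> bool" where
  "fisher_consistent Px K loss target \<longleftrightarrow>
     (AE x in Px. argmin_set (pointwise_risk loss (K x)) UNIV
                  \<subseteq> argmin_set (pointwise_risk target (K x)) UNIV)"

definition has_symmetric_density_positive_on ::
  "'a::euclidean_space measure \<Rightarrow> 'a \<Rightarrow> 'a set \<Rightarrow> bool" where
  "has_symmetric_density_positive_on Q c S \<longleftrightarrow>
     (\<exists>f :: 'a \<Rightarrow> real.
        f \<in> borel_measurable borel \<and> (\<forall>y. 0 \<le> f y) \<and>
        Q = density lborel (\<lambda>y. ennreal (f y)) \<and>
        (\<exists>U. open U \<and> S \<subseteq> U \<and> (\<forall>y\<in>U. 0 < f y)) \<and>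
        (\<forall>u. f (c + u) = f (c - u)))"

definition neg_normal_cone :: "'a::euclidean_space set \<Rightarrow> 'a \<Rightarrow> 'a set" where
  "neg_normal_cone Z z = uminus ` normal_cone Z z"

definition gamma_set :: "'a::euclidean_space set \<Rightarrow> 'a \<Rightarrow> real set" where
  "gamma_set Z ybar =
     {g. 0 \<le> g \<and> 2 *\<^sub>R ybar + g *\<^sub>R z_star Z ybar \<in> neg_normal_cone Z (z_star Z ybar)}"

definition gamma_bar :: "'a::euclidean_space set \<Rightarrow> 'a \<Rightarrow> ereal" where
  "gamma_bar Z ybar = (SUP g\<in>gamma_set Z ybar. ereal g)"

end

theory Submission
  imports Defs
begin

text \<open>
  Put \<open>h u = max {u \<bullet> z - \<gamma>/2 \<parallel>z\<parallel>\<^sup>2 | z \<in> Z}\<close>. It is convex, its gradient at \<open>u\<close> is the regularised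
  solution for the cost \<open>-u\<close>, and the RSPO+ risk is \<open>E h(y - yhat) + E z\<^sub>\<gamma>(y) \<bullet> yhat\<close> up to a constant.
  Symmetry of the law of \<open>y\<close> about \<open>c\<close> makes \<open>z\<^sub>\<gamma>(2c - y)\<close> and \<open>z\<^sub>\<gamma>(y)\<close> equal in mean, so the
  subgradient inequality for \<open>h\<close> at \<open>y - 2c\<close> shows that \<open>2c\<close> is a minimiser; it is the only one since
  the inequality is strict when \<open>y\<close> lies in the interior of \<open>2c + \<gamma>Z\<close>, where the density is positive.
  The RSPO risk is \<open>c \<bullet> z\<^sub>\<gamma>(yhat)\<close> up to a constant, and \<open>\<gamma> \<le> gamma_bar\<close> is precisely the
  optimality condition giving \<open>z\<^sub>\<gamma>(2c) = z_star c\<close>.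
  For a polytope, the unique solution of the linear problem beats the finitely many vertices strictly,
  which is stable under perturbation of \<open>c\<close>; hence \<open>c\<close> is interior to the negative normal cone.
\<close>

section \<open>Regularised and nominal minimisers\<close>

lemma argmin_set_iff: "x \<in> argmin_set f S \<longleftrightarrow> x \<in> S \<and> (\<forall>y\<in>S. f x \<le> f y)"
  by (auto simp: argmin_set_def is_arg_min_def not_less)

lemma neg_normal_cone_iff: "u \<in> neg_normal_cone Z z \<longleftrightarrow> (\<forall>w\<in>Z. 0 \<le> u \<bullet> (w - z))"
proof
  assume "\<forall>w\<in>Z. 0 \<le> u \<bullet> (w - z)"
  then have "- u \<in> normal_cone Z z"
    by (simp add: normal_cone_def)
  then show "u \<in> neg_normal_cone Z z"
    unfolding neg_normal_cone_def by (metis imageI minus_minus)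
qed (auto simp: neg_normal_cone_def normal_cone_def)

text \<open>As an intersection of closed half-spaces the cone is visibly closed and convex.\<close>

lemma neg_normal_cone_eq_Inter: "neg_normal_cone Z z = (\<Inter>w\<in>Z. {u. (w - z) \<bullet> u \<ge> 0})"
  by (auto simp: neg_normal_cone_iff inner_commute)

lemma closed_neg_normal_cone: "closed (neg_normal_cone Z z)"
  unfolding neg_normal_cone_eq_Inter by (intro closed_INT ballI closed_halfspace_ge)

lemma convex_neg_normal_cone: "convex (neg_normal_cone Z z)"
  unfolding neg_normal_cone_eq_Inter by (intro convex_INT convex_halfspace_ge)

lemma z_star_argmin:
  assumes "\<exists>!z. z \<in> argmin_set (\<lambda>z. c \<bullet> z) Z"
  shows "z_star Z c \<in> Z" "w \<in> Z \<Longrightarrow> c \<bullet> z_star Z c \<le> c \<bullet> w"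
    and "w \<in> Z \<Longrightarrow> w \<noteq> z_star Z c \<Longrightarrow> c \<bullet> z_star Z c < c \<bullet> w"
proof -
  have *: "z_star Z c \<in> argmin_set (\<lambda>z. c \<bullet> z) Z"
    unfolding z_star_def using assms by (rule theI')
  then show 1: "z_star Z c \<in> Z" and 2: "\<And>w. w \<in> Z \<Longrightarrow> c \<bullet> z_star Z c \<le> c \<bullet> w"
    by (auto simp: argmin_set_iff)
  show "c \<bullet> z_star Z c < c \<bullet> w" if "w \<in> Z" "w \<noteq> z_star Z c"
  proof (rule ccontr)
    assume "\<not> c \<bullet> z_star Z c < c \<bullet> w"
    then have "w \<in> argmin_set (\<lambda>z. c \<bullet> z) Z"
      using 2 that unfolding argmin_set_iff by fastforce
    with * assms that show False by blast
  qed
qed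

text \<open>Each functional \<open>y \<bullet> z\<close> with \<open>z \<in> Z\<close> is
  \<open>M\<close>-Lipschitz in \<open>y\<close>, hence so is their infimum. This later gives
  measurability and linear growth of \<open>v_star Z\<close>.\<close>

lemma abs_v_star_diff_le:
  fixes Z :: "'a::euclidean_space set"
  assumes "Z \<noteq> {}" and M: "\<And>z. z \<in> Z \<Longrightarrow> norm z \<le> M"
  shows "\<bar>v_star Z x - v_star Z y\<bar> \<le> M * norm (x - y)"
proof -
  have bdd: "bdd_below ((\<lambda>z. y \<bullet> z) ` Z)" for y
  proof (rule bdd_belowI2)
    fix z assume "z \<in> Z"
    then have "\<bar>y \<bullet> z\<bar> \<le> norm y * M"
      by (meson Cauchy_Schwarz_ineq2 M mult_left_mono norm_ge_zero order_trans)
    then show "- (norm y * M) \<le> y \<bullet> z" by linarith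
  qed
  have le: "v_star Z x - M * norm (x - y) \<le> v_star Z y" for x y
    unfolding v_star_def
  proof (rule cINF_greatest[OF assms(1)])
    fix z assume z: "z \<in> Z"
    have "(INF z\<in>Z. x \<bullet> z) \<le> x \<bullet> z"
      by (rule cINF_lower[OF bdd z])
    moreover have "(x - y) \<bullet> z \<le> norm (x - y) * M"
      by (meson norm_cauchy_schwarz M[OF z] mult_left_mono norm_ge_zero order_trans)
    ultimately show "(INF z\<in>Z. x \<bullet> z) - M * norm (x - y) \<le> y \<bullet> z"
      by (simp add: inner_diff_left mult.commute)
  qed
  show ?thesis
    using le[of x y] le[of y x] by (simp add: norm_minus_commute abs_le_iff)
qed

lemma continuous_on_v_star:
  fixes Z :: "'a::euclidean_space set"
  assumes "bounded Z" "Z \<noteq> {}"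
  shows "continuous_on UNIV (v_star Z)"
proof -
  obtain M where M: "0 < M" "\<And>z. z \<in> Z \<Longrightarrow> norm z \<le> M"
    using assms(1) by (auto simp: bounded_pos)
  have "M-lipschitz_on UNIV (v_star Z)"
    using abs_v_star_diff_le[OF assms(2) M(2)] M(1)
    by (intro lipschitz_onI) (auto simp: dist_norm)
  then show ?thesis
    by (rule lipschitz_on_continuous_on)
qed

section \<open>The regularised problem: projection and conjugate function\<close>

locale regularized_problem =
  fixes Z :: "'a::euclidean_space set" and \<gamma> :: real
  assumes compact: "compact Z" and convex: "convex Z" and nonempty: "Z \<noteq> {}"
    and gamma_pos: "0 < \<gamma>"
begin

text \<open>The objective is quadratic, so its expansion at \<open>q\<close> is exact: a first-order
  term, nonnegative by \<open>opt\<close>, plus a positive multiple of the squared distance to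
  \<open>q\<close>. This strict growth also gives the uniqueness behind the definite
  description.\<close>

lemma z_star_reg_eqI:
  assumes "q \<in> Z" and opt: "\<And>w. w \<in> Z \<Longrightarrow> 0 \<le> (y + \<gamma> *\<^sub>R q) \<bullet> (w - q)"
  shows "z_star_reg \<gamma> Z y = q"
proof -
  let ?f = "\<lambda>z. y \<bullet> z + \<gamma> / 2 * (norm z)\<^sup>2"
  have less: "?f q < ?f w" if "w \<in> Z" "w \<noteq> q" for w
  proof -
    have "?f w - ?f q = (y + \<gamma> *\<^sub>R q) \<bullet> (w - q) + \<gamma> / 2 * (norm (w - q))\<^sup>2"
      by (simp add: power2_norm_eq_inner inner_simps inner_commute field_simps)
    moreover have "0 < \<gamma> / 2 * (norm (w - q))\<^sup>2"
      using that gamma_pos by simp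
    ultimately show ?thesis using opt[OF that(1)] by linarith
  qed
  have "z \<in> argmin_set ?f Z \<longleftrightarrow> z = q" for z
    using less assms(1) unfolding argmin_set_iff by (metis less_eq_real_def not_less)
  then show ?thesis
    by (simp add: z_star_reg_def)
qed

text \<open>Up to a constant, the objective is a multiple of the squared distance to
  \<open>- (1 / \<gamma>) *\<^sub>R y\<close>. The obtuse-angle property of projections, multiplied
  by \<open>\<gamma>\<close>, is the first-order condition.\<close>

lemma z_star_reg_eq_closest_point: "z_star_reg \<gamma> Z y = closest_point Z (- (1 / \<gamma>) *\<^sub>R y)"
proof (rule z_star_reg_eqI)
  let ?p = "closest_point Z (- (1 / \<gamma>) *\<^sub>R y)"
  show "?p \<in> Z"
    by (simp add: closest_point_in_set compact compact_imp_closed nonempty)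
  fix w assume "w \<in> Z"
  then have "(- (1 / \<gamma>) *\<^sub>R y - ?p) \<bullet> (w - ?p) \<le> 0"
    using closest_point_dot compact compact_imp_closed convex by blast
  then have "\<gamma> * ((- (1 / \<gamma>) *\<^sub>R y - ?p) \<bullet> (w - ?p)) \<le> 0"
    using gamma_pos by (simp add: mult_le_0_iff)
  moreover have "\<gamma> * ((- (1 / \<gamma>) *\<^sub>R y - ?p) \<bullet> (w - ?p)) = - ((y + \<gamma> *\<^sub>R ?p) \<bullet> (w - ?p))"
  proof -
    have "\<gamma> *\<^sub>R (- (1 / \<gamma>) *\<^sub>R y - ?p) = - (y + \<gamma> *\<^sub>R ?p)"
      using gamma_pos by (simp add: scaleR_diff_right)
    then show ?thesis by (metis inner_minus_left inner_scaleR_left)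
  qed
  ultimately show "0 \<le> (y + \<gamma> *\<^sub>R ?p) \<bullet> (w - ?p)" by linarith
qed

lemma z_star_reg_in: "z_star_reg \<gamma> Z y \<in> Z"
  by (simp add: z_star_reg_eq_closest_point closest_point_in_set compact compact_imp_closed nonempty)

lemma z_star_reg_optimal:
  assumes "w \<in> Z"
  shows "y \<bullet> z_star_reg \<gamma> Z y + \<gamma> / 2 * (norm (z_star_reg \<gamma> Z y))\<^sup>2
         \<le> y \<bullet> w + \<gamma> / 2 * (norm w)\<^sup>2"
proof -
  let ?p = "z_star_reg \<gamma> Z y"
  have "dist (- (1 / \<gamma>) *\<^sub>R y) ?p \<le> dist (- (1 / \<gamma>) *\<^sub>R y) w"
    unfolding z_star_reg_eq_closest_point
    by (rule closest_point_le[OF compact_imp_closed[OF compact] assms])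
  then have "(norm (?p + (1 / \<gamma>) *\<^sub>R y))\<^sup>2 \<le> (norm (w + (1 / \<gamma>) *\<^sub>R y))\<^sup>2"
    by (simp add: dist_norm norm_minus_commute add.commute norm_minus_cancel[of "_ + _", symmetric]
        del: norm_minus_cancel)
  then have "\<gamma> / 2 * (norm (?p + (1 / \<gamma>) *\<^sub>R y))\<^sup>2 \<le> \<gamma> / 2 * (norm (w + (1 / \<gamma>) *\<^sub>R y))\<^sup>2"
    using gamma_pos by simp
  \<comment> \<open>Completing the square; the last summand is independent of \<open>z\<close> and
    cancels in the comparison.\<close>
  moreover have "\<gamma> / 2 * (norm (z + (1 / \<gamma>) *\<^sub>R y))\<^sup>2
      = y \<bullet> z + \<gamma> / 2 * (norm z)\<^sup>2 + (y \<bullet> y) / (2 * \<gamma>)" for z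
    using gamma_pos by (simp add: power2_norm_eq_inner inner_simps inner_commute field_simps)
  ultimately show ?thesis by simp
qed

lemma continuous_on_z_star_reg: "continuous_on UNIV (z_star_reg \<gamma> Z)"
proof -
  have "continuous_on UNIV (\<lambda>y. closest_point Z (- (1 / \<gamma>) *\<^sub>R y))"
    by (intro continuous_on_compose2[OF continuous_on_closest_point[of Z UNIV]] continuous_intros)
       (auto simp: convex compact compact_imp_closed nonempty)
  then show ?thesis
    by (simp add: z_star_reg_eq_closest_point[abs_def])
qed

text \<open>The convex conjugate of the regulariser restricted to \<open>Z\<close>, the function
  \<open>h\<close> of the overview. The maximiser is inserted explicitly: maximising at
  \<open>u\<close> is the regularised problem with cost \<open>- u\<close>.\<close>

definition reg_support :: "'a \<Rightarrow> real" where
  "reg_support u = u \<bullet> z_star_reg \<gamma> Z (- u) - \<gamma> / 2 * (norm (z_star_reg \<gamma> Z (- u)))\<^sup>2"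

lemma reg_support_ge: "z \<in> Z \<Longrightarrow> u \<bullet> z - \<gamma> / 2 * (norm z)\<^sup>2 \<le> reg_support u"
  using z_star_reg_optimal[of z "- u"] by (simp add: reg_support_def)

lemma reg_support_eq_SUP: "(SUP z\<in>Z. u \<bullet> z - \<gamma> / 2 * (norm z)\<^sup>2) = reg_support u"
proof (rule cSup_eq_maximum)
  show "reg_support u \<in> (\<lambda>z. u \<bullet> z - \<gamma> / 2 * (norm z)\<^sup>2) ` Z"
    by (rule image_eqI[where x = "z_star_reg \<gamma> Z (- u)"]) (rule reg_support_def, rule z_star_reg_in)
qed (elim imageE, simp only: reg_support_ge)

text \<open>With \<open>a = 1\<close> the two linear terms under the supremum merge into
  \<open>(y - x) \<bullet> z\<close>.\<close>

lemma rspo_plus_loss_eq: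
  "rspo_plus_loss 1 \<gamma> Z x y = reg_support (y - x)
     + (z_star_reg \<gamma> Z y \<bullet> x + \<gamma> / 2 * (norm (z_star_reg \<gamma> Z y))\<^sup>2) - v_star Z y"
  by (simp add: rspo_plus_loss_def reg_support_eq_SUP[symmetric] inner_diff_left)

text \<open>The maximiser at \<open>u\<close> is a competitor at \<open>u'\<close>.\<close>

lemma reg_support_subgradient:
  "reg_support u + z_star_reg \<gamma> Z (- u) \<bullet> (u' - u) \<le> reg_support u'"
  using reg_support_ge[OF z_star_reg_in, of u' "- u"]
  by (simp add: reg_support_def inner_diff_left inner_diff_right inner_commute)

text \<open>Here the maximiser at \<open>u\<close> is interior, so it can be moved a little in the
  direction \<open>u' - u\<close> without leaving \<open>Z\<close>, and this makes it a strictly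
  better competitor at \<open>u'\<close>.\<close>

lemma reg_support_subgradient_strict:
  assumes int: "(1 / \<gamma>) *\<^sub>R u \<in> interior Z" and ne: "u' \<noteq> u"
  shows "reg_support u + z_star_reg \<gamma> Z (- u) \<bullet> (u' - u) < reg_support u'"
proof -
  define p where "p = (1 / \<gamma>) *\<^sub>R u"
  define v where "v = u' - u"
  have u: "u = \<gamma> *\<^sub>R p"
    using gamma_pos by (simp add: p_def)
  have pZ: "p \<in> Z"
    using int interior_subset by (auto simp: p_def)
  \<comment> \<open>The gradient \<open>- u + \<gamma> *\<^sub>R p\<close> vanishes, so the
    first-order condition holds with equality.\<close>
  have q: "z_star_reg \<gamma> Z (- u) = p"
    by (rule z_star_reg_eqI[OF pZ]) (simp add: u)
  obtain e where e: "0 < e" "cball p e \<subseteq> Z"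
    using int mem_interior_cball p_def by blast
  have v0: "0 < norm v" using ne by (simp add: v_def)
  \<comment> \<open>The first bound keeps \<open>p + t *\<^sub>R v\<close> in the ball inside
    \<open>Z\<close>; the second keeps the factor \<open>1 - t * \<gamma> / 2\<close> of the gain at
    least one half.\<close>
  define t where "t = min (e / norm v) (1 / \<gamma>)"
  have t: "0 < t" "t * norm v \<le> e" "t * \<gamma> \<le> 1"
    using e v0 gamma_pos by (auto simp: t_def min_def field_simps)
  have "p + t *\<^sub>R v \<in> cball p e"
    using t by (simp add: dist_norm)
  then have "u' \<bullet> (p + t *\<^sub>R v) - \<gamma> / 2 * (norm (p + t *\<^sub>R v))\<^sup>2 \<le> reg_support u'"
    using e reg_support_ge by blast
  moreover have "u' \<bullet> (p + t *\<^sub>R v) - \<gamma> / 2 * (norm (p + t *\<^sub>R v))\<^sup>2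
      = u' \<bullet> p - \<gamma> / 2 * (norm p)\<^sup>2 + t * (1 - t * \<gamma> / 2) * (norm v)\<^sup>2"
  proof -
    have u': "u' = \<gamma> *\<^sub>R p + v" by (simp add: v_def u)
    show ?thesis
      unfolding u' by (simp add: power2_norm_eq_inner inner_simps inner_commute algebra_simps)
  qed
  moreover have "0 < t * (1 - t * \<gamma> / 2) * (norm v)\<^sup>2"
    using t v0 by simp
  ultimately show ?thesis
    by (simp add: reg_support_def q inner_diff_right inner_commute)
qed

end

section \<open>Risks\<close>

text \<open>Reflection through \<open>c\<close> preserves both Lebesgue measure and the
  density.\<close>

lemma integral_symmetric_density:
  fixes Q :: "'a::euclidean_space measure" and g :: "'a \<Rightarrow> 'b::{banach, second_countable_topology}"
  assumes "has_symmetric_density_positive_on Q c S" and g[measurable]: "g \<in> borel_measurable borel"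
  shows "(\<integral>y. g (2 *\<^sub>R c - y) \<partial>Q) = (\<integral>y. g y \<partial>Q)"
proof -
  obtain f :: "'a \<Rightarrow> real" where f[measurable]: "f \<in> borel_measurable borel"
    and f0: "\<And>y. 0 \<le> f y" and Q: "Q = density lborel (\<lambda>y. ennreal (f y))"
    and sym: "\<And>u. f (c + u) = f (c - u)"
    using assms(1) unfolding has_symmetric_density_positive_on_def by blast
  have f_refl: "f (2 *\<^sub>R c - y) = f y" for y
    using sym[of "c - y"] by (simp add: scaleR_2 algebra_simps)
  have refl: "distr lborel borel (\<lambda>y. 2 *\<^sub>R c - y) = lborel"
    using lborel_affine[of "-1" "2 *\<^sub>R c"] by (simp add: density_1)
  have "(\<integral>y. g y \<partial>Q) = (\<integral>y. f y *\<^sub>R g y \<partial>lborel)"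
    unfolding Q by (rule integral_density) (simp_all add: f0)
  also have "\<dots> = (\<integral>y. f y *\<^sub>R g y \<partial>distr lborel borel (\<lambda>y. 2 *\<^sub>R c - y))"
    by (simp only: refl)
  also have "\<dots> = (\<integral>y. f y *\<^sub>R g (2 *\<^sub>R c - y) \<partial>lborel)"
    by (subst integral_distr) (simp_all add: f_refl)
  also have "\<dots> = (\<integral>y. g (2 *\<^sub>R c - y) \<partial>Q)"
    unfolding Q by (rule integral_density[symmetric]) (simp_all add: f0)
  finally show ?thesis ..
qed

text \<open>The density is positive on \<open>V\<close>, so a \<open>Q\<close>-null \<open>V\<close>
  would be Lebesgue-null, which a nonempty open set is not.\<close>

lemma emeasure_pos_of_density_pos:
  fixes Q :: "'a::euclidean_space measure"
  assumes "has_symmetric_density_positive_on Q c S" "open V" "V \<noteq> {}" "V \<subseteq> S"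
  shows "emeasure Q V \<noteq> 0"
proof
  assume 0: "emeasure Q V = 0"
  obtain f :: "'a \<Rightarrow> real" where f[measurable]: "f \<in> borel_measurable borel"
    and Q: "Q = density lborel (\<lambda>y. ennreal (f y))" and pos: "\<And>y. y \<in> S \<Longrightarrow> 0 < f y"
    using assms(1) unfolding has_symmetric_density_positive_on_def by blast
  have V: "V \<in> sets borel"
    using assms(2) by simp
  have "AE y in Q. y \<notin> V"
    using 0 V by (intro AE_not_in) (simp add: null_sets_def Q)
  then have "AE y in lborel. 0 < f y \<longrightarrow> y \<notin> V"
    unfolding Q by (subst (asm) AE_density) auto
  then have "AE y in lborel. y \<notin> V"
    by eventually_elim (use pos assms(4) in blast)
  then have "V \<in> null_sets lborel"
    using V by (subst (asm) AE_iff_null_sets[symmetric]) auto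
  then have "negligible V"
    by (simp add: negligible_iff_null_sets null_sets_completionI)
  with open_not_negligible assms(2,3) show False by blast
qed

section \<open>Integrability of the losses and minimisers of the risks\<close>

locale regularized_problem_with_law = regularized_problem Z \<gamma> + prob_space Q
  for Z :: "'a::euclidean_space set" and \<gamma> :: real and Q :: "'a measure" +
  assumes sets_eq[measurable_cong]: "sets Q = sets borel"
    and integrable_id: "integrable Q (\<lambda>y. y)"
begin

lemma measurable_z_star_reg[measurable]: "z_star_reg \<gamma> Z \<in> borel_measurable borel"
  by (rule borel_measurable_continuous_onI[OF continuous_on_z_star_reg])

lemma measurable_v_star[measurable]: "v_star Z \<in> borel_measurable borel"
  by (rule borel_measurable_continuous_onI[OF continuous_on_v_star])
     (auto simp: compact compact_imp_bounded nonempty)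

lemma integrable_z_star_reg:
  assumes [measurable]: "g \<in> borel_measurable borel"
  shows "integrable Q (\<lambda>y. z_star_reg \<gamma> Z (g y))"
proof -
  obtain M where "\<And>z. z \<in> Z \<Longrightarrow> norm z \<le> M"
    using compact_imp_bounded[OF compact] by (auto simp: bounded_iff)
  then show ?thesis
    by (intro integrable_const_bound[of _ M]) (auto simp: z_star_reg_in)
qed

lemma integrable_norm_z_star_reg:
  assumes [measurable]: "g \<in> borel_measurable borel"
  shows "integrable Q (\<lambda>y. (norm (z_star_reg \<gamma> Z (g y)))\<^sup>2)"
proof -
  obtain M where "\<And>z. z \<in> Z \<Longrightarrow> norm z \<le> M"
    using compact_imp_bounded[OF compact] by (auto simp: bounded_iff)
  then show ?thesis
    by (intro integrable_const_bound[of _ "M\<^sup>2"]) (auto simp: z_star_reg_in power_mono)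
qed

text \<open>The linear part is at most \<open>M * norm (y - x)\<close>, integrable by the first
  moment; the quadratic part is bounded.\<close>

lemma integrable_reg_support: "integrable Q (\<lambda>y. reg_support (y - x))"
proof -
  obtain M where M: "0 < M" "\<And>z. z \<in> Z \<Longrightarrow> norm z \<le> M"
    using compact_imp_bounded[OF compact] by (auto simp: bounded_pos)
  have "integrable Q (\<lambda>y. (y - x) \<bullet> z_star_reg \<gamma> Z (- (y - x)))"
  proof (rule Bochner_Integration.integrable_bound)
    show "integrable Q (\<lambda>y. norm (y - x) * M)"
      by (intro integrable_mult_left integrable_norm Bochner_Integration.integrable_diff integrable_id) simp
    show "AE y in Q. norm ((y - x) \<bullet> z_star_reg \<gamma> Z (- (y - x))) \<le> norm (norm (y - x) * M)"
    proof (rule AE_I2)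
      fix y
      have "\<bar>(y - x) \<bullet> z_star_reg \<gamma> Z (- (y - x))\<bar> \<le> norm (y - x) * M"
        by (meson Cauchy_Schwarz_ineq2 M(2) z_star_reg_in mult_left_mono norm_ge_zero order_trans)
      then show "norm ((y - x) \<bullet> z_star_reg \<gamma> Z (- (y - x))) \<le> norm (norm (y - x) * M)"
        using M(1) by (simp add: abs_mult)
    qed
  qed measurable
  then show ?thesis
    unfolding reg_support_def
    by (intro Bochner_Integration.integrable_diff integrable_mult_right integrable_norm_z_star_reg)
       measurable
qed

lemma integrable_v_star: "integrable Q (v_star Z)"
proof -
  obtain M where M: "0 < M" "\<And>z. z \<in> Z \<Longrightarrow> norm z \<le> M"
    using compact_imp_bounded[OF compact] by (auto simp: bounded_pos)
  show ?thesis
  proof (rule Bochner_Integration.integrable_bound)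
    show "integrable Q (\<lambda>y. \<bar>v_star Z 0\<bar> + M * norm y)"
      by (intro Bochner_Integration.integrable_add integrable_mult_right integrable_norm integrable_id) simp
    show "AE y in Q. norm (v_star Z y) \<le> norm (\<bar>v_star Z 0\<bar> + M * norm y)"
    proof (rule AE_I2)
      fix y
      have "\<bar>v_star Z y - v_star Z 0\<bar> \<le> M * norm y"
        using abs_v_star_diff_le[OF nonempty M(2), of y 0] by simp
      then show "norm (v_star Z y) \<le> norm (\<bar>v_star Z 0\<bar> + M * norm y)"
        by simp
    qed
  qed measurable
qed

lemma integrable_rspo_plus_loss: "integrable Q (rspo_plus_loss 1 \<gamma> Z x)"
proof -
  have "integrable Q (\<lambda>y. reg_support (y - x)
      + (z_star_reg \<gamma> Z y \<bullet> x + \<gamma> / 2 * (norm (z_star_reg \<gamma> Z y))\<^sup>2) - v_star Z y)"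
    by (intro Bochner_Integration.integrable_add Bochner_Integration.integrable_diff
        integrable_mult_right integrable_inner_left integrable_reg_support integrable_v_star
        integrable_norm_z_star_reg integrable_z_star_reg) simp_all
  then show ?thesis
    by (simp add: rspo_plus_loss_eq[abs_def])
qed

text \<open>For each \<open>y\<close> the loss at \<open>x\<close> is at least the loss at
  \<open>2 *\<^sub>R c\<close> plus a term of mean zero, and strictly larger on an open set of
  positive mass. Integration gives the strict inequality of risks.\<close>

lemma pointwise_risk_rspo_plus_less:
  assumes dens: "has_symmetric_density_positive_on Q c ((\<lambda>z. 2 *\<^sub>R c + \<gamma> *\<^sub>R z) ` Z)"
    and int: "interior Z \<noteq> {}" and ne: "x \<noteq> 2 *\<^sub>R c"
  shows "pointwise_risk (rspo_plus_loss 1 \<gamma> Z) Q (2 *\<^sub>R c) < pointwise_risk (rspo_plus_loss 1 \<gamma> Z) Q x"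
proof -
  let ?q = "z_star_reg \<gamma> Z"
  define L where "L = rspo_plus_loss 1 \<gamma> Z"
  \<comment> \<open>The first-order change of the loss from \<open>2 *\<^sub>R c\<close> to
    \<open>x\<close>. Its mean is zero because \<open>y\<close> and \<open>2 *\<^sub>R c - y\<close>
    have the same law.\<close>
  define lin where "lin y = (?q y - ?q (2 *\<^sub>R c - y)) \<bullet> (x - 2 *\<^sub>R c)" for y
  \<comment> \<open>The interior of \<open>2 *\<^sub>R c + \<gamma> *\<^sub>R Z\<close>, as a
    preimage so that openness is immediate.\<close>
  define V where "V = (\<lambda>y. (1 / \<gamma>) *\<^sub>R (y - 2 *\<^sub>R c)) -` interior Z"
  have V: "open V"
    unfolding V_def by (intro open_vimage open_interior continuous_intros)
  have V_mem: "2 *\<^sub>R c + \<gamma> *\<^sub>R z \<in> V \<longleftrightarrow> z \<in> interior Z" for z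
    using gamma_pos by (simp add: V_def)
  have V_sub: "V \<subseteq> (\<lambda>z. 2 *\<^sub>R c + \<gamma> *\<^sub>R z) ` Z"
  proof
    fix y assume "y \<in> V"
    then have "(1 / \<gamma>) *\<^sub>R (y - 2 *\<^sub>R c) \<in> Z"
      using interior_subset by (auto simp: V_def)
    moreover have "y = 2 *\<^sub>R c + \<gamma> *\<^sub>R ((1 / \<gamma>) *\<^sub>R (y - 2 *\<^sub>R c))"
      using gamma_pos by simp
    ultimately show "y \<in> (\<lambda>z. 2 *\<^sub>R c + \<gamma> *\<^sub>R z) ` Z"
      by (rule rev_image_eqI)
  qed
  have iq: "integrable Q ?q" "integrable Q (\<lambda>y. ?q (2 *\<^sub>R c - y))"
    by (rule integrable_z_star_reg; measurable)+
  have lin_int: "integrable Q lin"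
    unfolding lin_def by (intro integrable_inner_left Bochner_Integration.integrable_diff iq)
  have lin0: "(\<integral>y. lin y \<partial>Q) = 0"
    using integral_symmetric_density[OF dens measurable_z_star_reg] iq
    by (simp add: lin_def integral_inner_left)
  \<comment> \<open>The norm and \<open>v_star\<close> terms cancel; what remains is the slack in
    the subgradient inequality from \<open>y - 2 *\<^sub>R c\<close> to
    \<open>y - x\<close>.\<close>
  have gap: "L x y - L (2 *\<^sub>R c) y - lin y
      = reg_support (y - x) - (reg_support (y - 2 *\<^sub>R c)
          + ?q (- (y - 2 *\<^sub>R c)) \<bullet> ((y - x) - (y - 2 *\<^sub>R c)))" for y
    by (simp add: L_def rspo_plus_loss_eq lin_def inner_simps)
  have "(\<integral>y. L (2 *\<^sub>R c) y + lin y \<partial>Q) < (\<integral>y. L x y \<partial>Q)"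
  proof (rule integral_less_AE)
    show "integrable Q (\<lambda>y. L (2 *\<^sub>R c) y + lin y)" "integrable Q (L x)"
      using integrable_rspo_plus_loss lin_int by (simp_all add: L_def)
    show "emeasure Q V \<noteq> 0"
      using int V_mem by (intro emeasure_pos_of_density_pos[OF dens V _ V_sub]) blast
    show "V \<in> sets Q"
      using V by (simp add: sets_eq)
    show "AE y in Q. y \<in> V \<longrightarrow> L (2 *\<^sub>R c) y + lin y \<noteq> L x y"
    proof (intro AE_I2 impI)
      fix y assume "y \<in> V"
      then show "L (2 *\<^sub>R c) y + lin y \<noteq> L x y"
        using reg_support_subgradient_strict[of "y - 2 *\<^sub>R c" "y - x"] gap[of y] ne
        by (auto simp: V_def)
    qed
    show "AE y in Q. L (2 *\<^sub>R c) y + lin y \<le> L x y"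
    proof (rule AE_I2)
      fix y
      show "L (2 *\<^sub>R c) y + lin y \<le> L x y"
        using reg_support_subgradient[of "y - 2 *\<^sub>R c" "y - x"] gap[of y] by linarith
    qed
  qed
  moreover have "(\<integral>y. L (2 *\<^sub>R c) y + lin y \<partial>Q) = (\<integral>y. L (2 *\<^sub>R c) y \<partial>Q)"
    using integrable_rspo_plus_loss lin_int lin0
    by (subst Bochner_Integration.integral_add) (simp_all add: L_def)
  ultimately show ?thesis
    by (simp add: pointwise_risk_def L_def)
qed

lemma argmin_rspo_plus_risk:
  assumes "has_symmetric_density_positive_on Q c ((\<lambda>z. 2 *\<^sub>R c + \<gamma> *\<^sub>R z) ` Z)" "interior Z \<noteq> {}"
  shows "argmin_set (pointwise_risk (rspo_plus_loss 1 \<gamma> Z) Q) UNIV = {2 *\<^sub>R c}"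
  using pointwise_risk_rspo_plus_less[OF assms]
  by (auto simp: argmin_set_iff) (metis less_eq_real_def not_less)+

text \<open>The decision depends on \<open>x\<close> only and the cost enters linearly, so only the
  mean of \<open>y\<close> matters.\<close>

lemma pointwise_risk_rspo:
  "pointwise_risk (rspo_loss \<gamma> Z) Q x = cond_mean Q \<bullet> z_star_reg \<gamma> Z x - (\<integral>y. v_star Z y \<partial>Q)"
  using integrable_id integrable_v_star
  by (simp add: pointwise_risk_def rspo_loss_def cond_mean_def)

text \<open>Membership in \<open>gamma_set\<close> is the first-order condition of
  \<open>z_star Z (cond_mean Q)\<close> for the regularised problem with cost
  \<open>2 *\<^sub>R cond_mean Q\<close>. The prediction thus induces the nominal solution, and no
  decision in \<open>Z\<close> has smaller mean cost.\<close>

lemma argmin_rspo_risk: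
  assumes uniq: "\<exists>!z. z \<in> argmin_set (\<lambda>z. cond_mean Q \<bullet> z) Z"
    and mem: "\<gamma> \<in> gamma_set Z (cond_mean Q)"
  shows "2 *\<^sub>R cond_mean Q \<in> argmin_set (pointwise_risk (rspo_loss \<gamma> Z) Q) UNIV"
proof -
  have "z_star_reg \<gamma> Z (2 *\<^sub>R cond_mean Q) = z_star Z (cond_mean Q)"
    using mem z_star_argmin(1)[OF uniq]
    by (intro z_star_reg_eqI) (auto simp: gamma_set_def neg_normal_cone_iff)
  then show ?thesis
    using z_star_argmin(2)[OF uniq z_star_reg_in] by (simp add: argmin_set_iff pointwise_risk_rspo)
qed

end

section \<open>The threshold\<close>

lemma zero_in_gamma_set:
  assumes "\<exists>!z. z \<in> argmin_set (\<lambda>z. c \<bullet> z) Z"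
  shows "0 \<in> gamma_set Z c"
  using z_star_argmin(2)[OF assms] by (auto simp: gamma_set_def neg_normal_cone_iff inner_diff_right)

text \<open>A half-line meets the preimage of a closed convex cone under an affine map; closedness
  and convexity pass to the preimage.\<close>

lemma gamma_set_eq:
  "gamma_set Z c = {0..} \<inter> (\<lambda>g. 2 *\<^sub>R c + g *\<^sub>R z_star Z c) -` neg_normal_cone Z (z_star Z c)"
  by (auto simp: gamma_set_def)

lemma closed_gamma_set: "closed (gamma_set Z c)"
  unfolding gamma_set_eq
  by (intro closed_Int closed_atLeast closed_vimage closed_neg_normal_cone continuous_intros)

lemma is_interval_gamma_set: "is_interval (gamma_set Z c)"
proof -
  have "convex ((\<lambda>g. 2 *\<^sub>R c + g *\<^sub>R z_star Z c) -` neg_normal_cone Z (z_star Z c))"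
  proof (rule convexI)
    fix s t u v :: real
    assume *: "s \<in> (\<lambda>g. 2 *\<^sub>R c + g *\<^sub>R z_star Z c) -` neg_normal_cone Z (z_star Z c)"
      "t \<in> (\<lambda>g. 2 *\<^sub>R c + g *\<^sub>R z_star Z c) -` neg_normal_cone Z (z_star Z c)"
      and uv: "0 \<le> u" "0 \<le> v" "u + v = 1"
    have "u *\<^sub>R (2 *\<^sub>R c + s *\<^sub>R z_star Z c) + v *\<^sub>R (2 *\<^sub>R c + t *\<^sub>R z_star Z c)
        \<in> neg_normal_cone Z (z_star Z c)"
      using * uv by - (rule convexD[OF convex_neg_normal_cone], simp_all only: vimage_eq)
    moreover have "u *\<^sub>R (2 *\<^sub>R c + s *\<^sub>R z_star Z c) + v *\<^sub>R (2 *\<^sub>R c + t *\<^sub>R z_star Z c)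
        = (u + v) *\<^sub>R (2 *\<^sub>R c) + (u *\<^sub>R s + v *\<^sub>R t) *\<^sub>R z_star Z c"
      by (simp add: algebra_simps)
    ultimately show "u *\<^sub>R s + v *\<^sub>R t
        \<in> (\<lambda>g. 2 *\<^sub>R c + g *\<^sub>R z_star Z c) -` neg_normal_cone Z (z_star Z c)"
      by (simp add: uv(3))
  qed
  then show ?thesis
    unfolding gamma_set_eq is_interval_convex_1 by (intro convex_Int) simp_all
qed

text \<open>A finite threshold bounds the set, and a nonempty closed set of reals that is bounded
  above contains its supremum.\<close>

lemma gamma_bar_attained:
  assumes "0 \<in> gamma_set Z c" "gamma_bar Z c \<noteq> \<infinity>"
  shows "gamma_bar Z c \<in> ereal ` gamma_set Z c"
proof -
  have upper: "ereal g \<le> gamma_bar Z c" if "g \<in> gamma_set Z c" for g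
    unfolding gamma_bar_def using that by (rule SUP_upper)
  obtain r where r: "gamma_bar Z c = ereal r"
    using assms(2) upper[OF assms(1)] by (cases "gamma_bar Z c") auto
  have bdd: "bdd_above (gamma_set Z c)"
    using upper r by (intro bdd_aboveI[of _ r]) auto
  then have Sup: "Sup (gamma_set Z c) \<in> gamma_set Z c"
    using assms(1) closed_gamma_set by (intro closed_contains_Sup) auto
  have "gamma_bar Z c \<le> ereal (Sup (gamma_set Z c))"
    unfolding gamma_bar_def by (intro SUP_least) (simp add: cSup_upper bdd)
  with upper[OF Sup] show ?thesis
    using Sup by (intro image_eqI[of _ _ "Sup (gamma_set Z c)"]) auto
qed

text \<open>Some member of the set is at least \<open>g\<close>: the attained supremum if it is
  finite, any large member otherwise. The interval property fills in down to 0.\<close>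

lemma mem_gamma_set_of_le_gamma_bar:
  assumes 0: "0 \<in> gamma_set Z c" and g: "0 \<le> g" "ereal g \<le> gamma_bar Z c"
  shows "g \<in> gamma_set Z c"
proof -
  have "\<exists>h\<in>gamma_set Z c. g \<le> h"
  proof (cases "gamma_bar Z c = \<infinity>")
    case True
    then have "ereal g < (SUP h\<in>gamma_set Z c. ereal h)"
      by (simp add: gamma_bar_def)
    then show ?thesis
      by (auto simp: less_SUP_iff intro: less_imp_le)
  next
    case False
    then show ?thesis
      using gamma_bar_attained[OF 0] g(2) by auto
  qed
  then show ?thesis
    using is_interval_gamma_set 0 g(1) unfolding is_interval_1 by blast
qed

section \<open>Positivity of the threshold\<close>

lemma gamma_bar_eq_infinity:
  assumes "\<exists>!z. z \<in> argmin_set (\<lambda>z. c \<bullet> z) Z" "z_star Z c = 0"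
  shows "gamma_bar Z c = \<infinity>"
proof -
  have "2 *\<^sub>R c \<in> neg_normal_cone Z 0"
    using zero_in_gamma_set[OF assms(1)] assms(2) by (simp add: gamma_set_def)
  \<comment> \<open>With a zero nominal solution the defining condition no longer depends on
    \<open>g\<close>.\<close>
  then have "g \<in> gamma_set Z c" if "0 \<le> g" for g
    using that assms(2) by (simp add: gamma_set_def)
  then have "ereal (real n) \<le> gamma_bar Z c" for n
    unfolding gamma_bar_def by (intro SUP_upper) simp
  then show ?thesis
    by (metis ereal_infty_less_eq(1) SUP_least SUP_nat_Infty top_ereal_def top.extremum_uniqueI)
qed

text \<open>The cone contains the closed ball about \<open>c\<close> whose radius is the distance to
  its boundary. A step of that length along \<open>z_star Z c\<close> stays in the cone, and
  doubling the result gives the defining condition.\<close>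

lemma gamma_bar_ge_infdist:
  fixes Z :: "'a::euclidean_space set"
  assumes uniq: "\<exists>!z. z \<in> argmin_set (\<lambda>z. c \<bullet> z) Z" and nz: "z_star Z c \<noteq> 0"
  shows "ereal (2 * infdist c (frontier (neg_normal_cone Z (z_star Z c))) / norm (z_star Z c))
         \<le> gamma_bar Z c"
proof -
  define C where "C = neg_normal_cone Z (z_star Z c)"
  define r where "r = infdist c (frontier C)"
  define g where "g = 2 * r / norm (z_star Z c)"
  have r0: "0 \<le> r" by (simp add: r_def infdist_nonneg)
  have cC: "c \<in> C"
    using z_star_argmin(2)[OF uniq] by (simp add: C_def neg_normal_cone_iff inner_diff_right)
  have ball: "ball c r \<subseteq> C"
  proof (rule ccontr)
    assume "\<not> ball c r \<subseteq> C"
    then have ne: "ball c r - C \<noteq> {}" by auto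
    then have "ball c r \<noteq> {}" by blast
    then have "c \<in> ball c r" by simp
    \<comment> \<open>A connected set that meets both \<open>C\<close> and its complement meets the
      frontier.\<close>
    with cC ne have "ball c r \<inter> frontier C \<noteq> {}"
      by (intro connected_Int_frontier connected_ball) blast+
    then obtain f where "f \<in> frontier C" "dist c f < r" by auto
    with infdist_le[of f "frontier C" c] show False by (simp add: r_def)
  qed
  have cball: "cball c r \<subseteq> C"
  \<comment> \<open>For \<open>r = 0\<close> the open ball is empty and its closure misses
    \<open>c\<close>, hence the separate case.\<close>
  proof (cases "r = 0")
    case True
    then show ?thesis using cC by simp
  next
    case False
    then have "cball c r = closure (ball c r)" using r0 by simp
    also have "\<dots> \<subseteq> C"
      using ball closed_neg_normal_cone by (intro closure_minimal) (auto simp: C_def)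
    finally show ?thesis .
  qed
  have g: "0 \<le> g" using r0 by (simp add: g_def)
  \<comment> \<open>By the choice of \<open>g\<close> this step has length exactly \<open>r\<close>,
    so the point lies on the sphere; hence the closed ball.\<close>
  have "c + (g / 2) *\<^sub>R z_star Z c \<in> cball c r"
    using nz r0 by (simp add: g_def dist_norm)
  with cball have "c + (g / 2) *\<^sub>R z_star Z c \<in> C" by blast
  then have "2 *\<^sub>R c + g *\<^sub>R z_star Z c \<in> C"
  proof -
    have "2 *\<^sub>R c + g *\<^sub>R z_star Z c = 2 *\<^sub>R (c + (g / 2) *\<^sub>R z_star Z c)"
      by (simp add: scaleR_add_right)
    then show ?thesis
      using \<open>c + (g / 2) *\<^sub>R z_star Z c \<in> C\<close>
      unfolding C_def neg_normal_cone_iff by (simp only: inner_scaleR_left) simp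
  qed
  with g have "g \<in> gamma_set Z c"
    by (simp add: gamma_set_def C_def)
  then show ?thesis
    unfolding gamma_bar_def g_def r_def C_def by (rule SUP_upper)
qed

text \<open>Uniqueness makes the inequalities at the finitely many generators other than the
  solution strict, an open condition on the cost. They extend to \<open>Z\<close> because a
  half-space containing the generators contains their hull.\<close>

lemma interior_neg_normal_cone_polytope:
  fixes Z :: "'a::euclidean_space set"
  assumes "polytope Z" and uniq: "\<exists>!z. z \<in> argmin_set (\<lambda>z. c \<bullet> z) Z"
  shows "c \<in> interior (neg_normal_cone Z (z_star Z c))"
proof -
  obtain V where V: "finite V" "Z = convex hull V"
    using assms(1) by (auto simp: polytope_def)
  let ?z = "z_star Z c"
  let ?O = "\<Inter>v\<in>V - {?z}. {u. (v - ?z) \<bullet> u > 0}"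
  have "open ?O"
    using V(1) by (intro open_INT ballI open_halfspace_gt) simp
  moreover have "c \<in> ?O"
    using z_star_argmin(3)[OF uniq] hull_subset[of V convex] V(2)
    by (auto simp: inner_diff_left inner_diff_right inner_commute)
  moreover have "?O \<subseteq> neg_normal_cone Z ?z"
  proof
    fix u assume u: "u \<in> ?O"
    have "V \<subseteq> {w. u \<bullet> w \<ge> u \<bullet> ?z}"
    proof
      fix v assume "v \<in> V"
      with u show "v \<in> {w. u \<bullet> w \<ge> u \<bullet> ?z}"
        by (cases "v = ?z") (auto simp: inner_diff_right inner_commute[of _ u] less_imp_le)
    qed
    then have "Z \<subseteq> {w. u \<bullet> w \<ge> u \<bullet> ?z}"
      unfolding V(2) by (intro hull_minimal convex_halfspace_ge)
    then show "u \<in> neg_normal_cone Z ?z"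
      by (auto simp: neg_normal_cone_iff inner_diff_right)
  qed
  ultimately show ?thesis
    by (rule interiorI)
qed

text \<open>The vector \<open>z - w\<close> has negative inner product with
  \<open>w - z\<close>.\<close>

lemma neg_normal_cone_neq_UNIV:
  assumes "w \<in> Z" "w \<noteq> z"
  shows "neg_normal_cone Z z \<noteq> UNIV"
proof
  assume "neg_normal_cone Z z = UNIV"
  then have "z - w \<in> neg_normal_cone Z z" by simp
  then have "0 \<le> (z - w) \<bullet> (w - z)"
    using assms(1) by (simp add: neg_normal_cone_iff)
  moreover have "(z - w) \<bullet> (w - z) = - ((w - z) \<bullet> (w - z))"
    by (metis inner_minus_left minus_diff_eq)
  moreover have "0 < (w - z) \<bullet> (w - z)"
    using assms(2) by (subst inner_gt_zero_iff) simp
  ultimately show False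
    by linarith
qed

text \<open>An interior point is off the closed frontier. The frontier must also be shown nonempty,
  since \<open>infdist\<close> to the empty set is 0 by convention.\<close>

lemma infdist_frontier_neg_normal_cone_pos:
  fixes Z :: "'a::euclidean_space set"
  assumes "polytope Z" "interior Z \<noteq> {}" and uniq: "\<exists>!z. z \<in> argmin_set (\<lambda>z. c \<bullet> z) Z"
  shows "0 < infdist c (frontier (neg_normal_cone Z (z_star Z c)))"
proof -
  let ?C = "neg_normal_cone Z (z_star Z c)"
  have c: "c \<in> interior ?C"
    by (rule interior_neg_normal_cone_polytope[OF assms(1) uniq])
  \<comment> \<open>Singletons are not open, so \<open>Z\<close> has a point other than the
    solution.\<close>
  have "interior Z \<noteq> {z_star Z c}"
    using not_open_singleton open_interior by metis
  then obtain w where "w \<in> Z" "w \<noteq> z_star Z c"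
    using assms(2) interior_subset by blast
  then have "?C \<noteq> UNIV"
    by (rule neg_normal_cone_neq_UNIV)
  then have ne: "frontier ?C \<noteq> {}"
    using c interior_subset frontier_eq_empty by blast
  have "c \<notin> frontier ?C"
    using c by (simp add: frontier_def)
  then show ?thesis
    using infdist_pos_not_in_closed[OF frontier_closed ne] by blast
qed

text \<open>Each row of \<open>A\<close> contributes one half-space, and there are finitely many
  rows.\<close>

lemma polyhedron_matrix_ge:
  fixes A :: "real ^ 'd ^ 'm" and b :: "real ^ 'm"
  shows "polyhedron {z. \<forall>i. (A *v z) $ i \<ge> b $ i}"
proof -
  have "{z. \<forall>i. (A *v z) $ i \<ge> b $ i} = \<Inter> (range (\<lambda>i. {z. A $ i \<bullet> z \<ge> b $ i}))"
    by (auto simp: matrix_vector_mul_component)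
  also have "polyhedron \<dots>"
    by (rule polyhedron_Inter) (auto intro: polyhedron_halfspace_ge)
  finally show ?thesis .
qed


section \<open>Assembly for almost every covariate\<close>

theorem theorem2:
  fixes P :: "((real ^ 'p) \<times> (real ^ 'd)) measure"
    and X :: "(real ^ 'p) set"
    and Y :: "(real ^ 'd) set"
    and K :: "real ^ 'p \<Rightarrow> (real ^ 'd) measure"
    and Px :: "(real ^ 'p) measure"
    and ybar :: "real ^ 'p \<Rightarrow> real ^ 'd"
    and Z :: "(real ^ 'd) set"
    and \<gamma> :: real
    and A :: "real ^ 'd ^ 'm"
    and b :: "real ^ 'm"
  defines "Px \<equiv> distr P borel fst"
    and "ybar \<equiv> \<lambda>x. cond_mean (K x)"
  assumes "prob_space P"
    and "sets P = sets borel"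
    and "AE (x, y) in P. x \<in> X \<and> y \<in> Y"
    and "is_cond_distribution P K"
    and "compact Z" "convex Z" "interior Z \<noteq> {}"
    and "0 < \<gamma>"
    and "AE x in Px. (\<integral>\<^sup>+y. ennreal (norm y) \<partial>(K x)) < \<infinity>"
    and "AE x in Px. \<exists>!z. z \<in> argmin_set (\<lambda>z. ybar x \<bullet> z) Z"
    and "AE x in Px. has_symmetric_density_positive_on (K x) (ybar x)
           ((\<lambda>z. 2 *\<^sub>R ybar x + \<gamma> *\<^sub>R z) ` Z)"
  shows
    "(AE x in Px.
        0 \<in> gamma_set Z (ybar x) \<and>
        closed (gamma_set Z (ybar x)) \<and>
        is_interval (gamma_set Z (ybar x)) \<and>
        (gamma_bar Z (ybar x) \<noteq> \<infinity> \<longrightarrow>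
           gamma_bar Z (ybar x) \<in> ereal ` gamma_set Z (ybar x)))
     \<and>
     ((AE x in Px. ereal \<gamma> \<le> gamma_bar Z (ybar x)) \<longrightarrow>
        (AE x in Px.
           argmin_set (pointwise_risk (rspo_plus_loss 1 \<gamma> Z) (K x)) UNIV = {2 *\<^sub>R ybar x} \<and>
           2 *\<^sub>R ybar x \<in> argmin_set (pointwise_risk (rspo_loss \<gamma> Z) (K x)) UNIV) \<and>
        fisher_consistent Px K (rspo_plus_loss 1 \<gamma> Z) (rspo_loss \<gamma> Z))
     \<and>
     (Z = {z. \<forall>i. (A *v z) $ i \<ge> b $ i} \<longrightarrow>
        (AE x in Px.
           0 < gamma_bar Z (ybar x) \<and>
           (z_star Z (ybar x) \<noteq> 0 \<longrightarrow>
              ereal (2 * infdist (ybar x) (frontier (neg_normal_cone Z (z_star Z (ybar x))))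
                     / norm (z_star Z (ybar x))) \<le> gamma_bar Z (ybar x) \<and>
              0 < 2 * infdist (ybar x) (frontier (neg_normal_cone Z (z_star Z (ybar x))))
                  / norm (z_star Z (ybar x))) \<and>
           (z_star Z (ybar x) = 0 \<longrightarrow> gamma_bar Z (ybar x) = \<infinity>) \<and>
           {g :: real. 0 < g \<and> ereal g \<le> gamma_bar Z (ybar x)} \<noteq> {}))"
proof -
  have Z: "Z \<noteq> {}"
    using \<open>interior Z \<noteq> {}\<close> by auto
  interpret regularized_problem Z \<gamma>
    using \<open>compact Z\<close> \<open>convex Z\<close> \<open>0 < \<gamma>\<close> Z by unfold_locales
  \<comment> \<open>Measurability into \<open>prob_algebra\<close> makes this true for every
    \<open>x\<close>, not only almost every one.\<close>
  have K: "prob_space (K x)" "sets (K x) = sets borel" for x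
  proof -
    have "K x \<in> space (prob_algebra borel)"
      using \<open>is_cond_distribution P K\<close> unfolding is_cond_distribution_def
      by (auto dest: measurable_space)
    then show "prob_space (K x)" "sets (K x) = sets borel"
      by (auto simp: space_prob_algebra)
  qed
  have law: "regularized_problem_with_law Z \<gamma> (K x)"
    if "(\<integral>\<^sup>+y. ennreal (norm y) \<partial>(K x)) < \<infinity>" for x
  proof -
    interpret prob_space "K x" by (rule K)
    have "(\<lambda>y. y) \<in> borel_measurable (K x)"
      using K(2) by (simp add: measurable_cong_sets[OF K(2) refl])
    then show ?thesis
      using K that by unfold_locales (auto simp: integrable_iff_bounded)
  qed
  note uniq = \<open>AE x in Px. \<exists>!z. z \<in> argmin_set (\<lambda>z. ybar x \<bullet> z) Z\<close>
  have interval: "AE x in Px. 0 \<in> gamma_set Z (ybar x) \<and> closed (gamma_set Z (ybar x)) \<and>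
      is_interval (gamma_set Z (ybar x)) \<and>
      (gamma_bar Z (ybar x) \<noteq> \<infinity> \<longrightarrow> gamma_bar Z (ybar x) \<in> ereal ` gamma_set Z (ybar x))"
    using uniq
    by eventually_elim
      (intro conjI impI gamma_bar_attained zero_in_gamma_set closed_gamma_set is_interval_gamma_set)
  have minimizers: "AE x in Px.
      argmin_set (pointwise_risk (rspo_plus_loss 1 \<gamma> Z) (K x)) UNIV = {2 *\<^sub>R ybar x} \<and>
      2 *\<^sub>R ybar x \<in> argmin_set (pointwise_risk (rspo_loss \<gamma> Z) (K x)) UNIV"
    if "AE x in Px. ereal \<gamma> \<le> gamma_bar Z (ybar x)"
    using that uniq \<open>AE x in Px. (\<integral>\<^sup>+y. ennreal (norm y) \<partial>(K x)) < \<infinity>\<close>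
      \<open>AE x in Px. has_symmetric_density_positive_on (K x) (ybar x)
           ((\<lambda>z. 2 *\<^sub>R ybar x + \<gamma> *\<^sub>R z) ` Z)\<close>
  proof eventually_elim
    case (elim x)
    interpret regularized_problem_with_law Z \<gamma> "K x"
      by (rule law[OF elim(3)])
    have "\<gamma> \<in> gamma_set Z (ybar x)"
      using elim(1) gamma_pos
      by (intro mem_gamma_set_of_le_gamma_bar[OF zero_in_gamma_set[OF elim(2)]]) simp_all
    then show ?case
      using argmin_rspo_plus_risk[OF elim(4) \<open>interior Z \<noteq> {}\<close>] argmin_rspo_risk elim(2)
      unfolding ybar_def by blast
  qed
  have consistent: "fisher_consistent Px K (rspo_plus_loss 1 \<gamma> Z) (rspo_loss \<gamma> Z)"
    if "AE x in Px. ereal \<gamma> \<le> gamma_bar Z (ybar x)"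
    unfolding fisher_consistent_def using minimizers[OF that] by eventually_elim simp
  have polyhedral: "AE x in Px.
           0 < gamma_bar Z (ybar x) \<and>
           (z_star Z (ybar x) \<noteq> 0 \<longrightarrow>
              ereal (2 * infdist (ybar x) (frontier (neg_normal_cone Z (z_star Z (ybar x))))
                     / norm (z_star Z (ybar x))) \<le> gamma_bar Z (ybar x) \<and>
              0 < 2 * infdist (ybar x) (frontier (neg_normal_cone Z (z_star Z (ybar x))))
                  / norm (z_star Z (ybar x))) \<and>
           (z_star Z (ybar x) = 0 \<longrightarrow> gamma_bar Z (ybar x) = \<infinity>) \<and>
           {g :: real. 0 < g \<and> ereal g \<le> gamma_bar Z (ybar x)} \<noteq> {}"
    if "Z = {z. \<forall>i. (A *v z) $ i \<ge> b $ i}"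
    using uniq
  proof eventually_elim
    case (elim x)
    let ?bound = "2 * infdist (ybar x) (frontier (neg_normal_cone Z (z_star Z (ybar x))))
                  / norm (z_star Z (ybar x))"
    have "polytope Z"
      using that polyhedron_matrix_ge[of b A] compact_imp_bounded[OF compact]
      by (simp add: polytope_eq_bounded_polyhedron)
    then have pos: "0 < infdist (ybar x) (frontier (neg_normal_cone Z (z_star Z (ybar x))))"
      using \<open>interior Z \<noteq> {}\<close> elim by (rule infdist_frontier_neg_normal_cone_pos)
    have nonzero: "ereal ?bound \<le> gamma_bar Z (ybar x)" "0 < ?bound" if "z_star Z (ybar x) \<noteq> 0"
      using gamma_bar_ge_infdist[OF elim that] pos that by simp_all
    have zero: "gamma_bar Z (ybar x) = \<infinity>" if "z_star Z (ybar x) = 0"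
      by (rule gamma_bar_eq_infinity[OF elim that])
    \<comment> \<open>The witness is 1 if the nominal solution is zero, and the distance bound
      itself otherwise.\<close>
    have "\<exists>g::real. 0 < g \<and> ereal g \<le> gamma_bar Z (ybar x)"
    proof (cases "z_star Z (ybar x) = 0")
      case True
      then show ?thesis using zero by (intro exI[of _ 1]) simp
    next
      case False
      then show ?thesis using nonzero by blast
    qed
    then obtain g :: real where g: "0 < g" "ereal g \<le> gamma_bar Z (ybar x)" by blast
    then have "0 < gamma_bar Z (ybar x)"
      by (meson ereal_less(2) less_le_trans)
    with g nonzero zero show ?case by blast
  qed
  show ?thesis
    using interval minimizers consistent polyhedral by blast
qed

end
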